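(* Let $n\ge1$ and let $w$ be any (real-valued, not necessarily simple) walk of length $n$. Then $$Q(w)(j)\ge0\quad\text{for } j\in[0,\phi_w^{-1}(n)),\qquad\text{and}\qquad Q(w)(j)>Q(w)(n)\quad\text{for } j\in[\phi_w^{-1}(n),n).$$ Consequently, $Q(w)$ is a non-negative walk in the case $w(n)\ge0$, and a first-passage bridge to a negative value in the case $w(n)<0$.
   Context: Intervals $[a,b]$, $[a,b)$ denote intervals of integers. A walk of length $n$ is a function $w:[0,n]\to\mathbb R$ with $w(0)=0$; its increments are $x_i=w(i)-w(i-1)$, $i\in[1,n]$. The quantile permutation $\phi_w$ is the unique permutation of $[1,n]$ such that $(w(\phi_w(1)-1),\phi_w(1)-1),\dots,(w(\phi_w(n)-1),\phi_w(n)-1)$ is the increasing lexicographic reordering of $(w(0),0),(w(1),1),\dots,(w(n-1),n-1)$. The quantile transform of $w$ is the walk $Q(w)(j)=\sum_{i=1}^jx_{\phi_w(i)}$, $j\in[0,n]$. A non-negative walk is a walk that is $\ge0$ at all times. A first-passage bridge of length $n$ is a walk $v$ of length $n$ which does not reach $v(n)$ prior to time $n$. *)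

theory Defs
  imports Complex_Main "HOL-Library.Product_Lexorder" "HOL-Combinatorics.Permutations"
begin

text \<open>
  A walk of length \<open>n\<close> is represented by a function on all of \<open>nat\<close>; only its values on
  \<open>{0..n}\<close> are meaningful, and every notion below that takes the length \<open>n\<close> inspects only those.
\<close>

definition walk :: "(nat \<Rightarrow> real) \<Rightarrow> bool" where
  "walk w \<longleftrightarrow> w 0 = 0"

definition increment :: "(nat \<Rightarrow> real) \<Rightarrow> nat \<Rightarrow> real" where
  "increment w i = w i - w (i - 1)"

text \<open>The order on pairs is the lexicographic one of \<^theory>\<open>HOL-Library.Product_Lexorder\<close>.\<close>

definition is_quantile_perm :: "nat \<Rightarrow> (nat \<Rightarrow> real) \<Rightarrow> (nat \<Rightarrow> nat) \<Rightarrow> bool" where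
  "is_quantile_perm n w \<phi> \<longleftrightarrow>
     \<phi> permutes {1..n} \<and> strict_mono_on {1..n} (\<lambda>i. (w (\<phi> i - 1), \<phi> i - 1))"

definition quantile_perm :: "nat \<Rightarrow> (nat \<Rightarrow> real) \<Rightarrow> nat \<Rightarrow> nat" where
  "quantile_perm n w = (THE \<phi>. is_quantile_perm n w \<phi>)"

definition quantile_transform :: "nat \<Rightarrow> (nat \<Rightarrow> real) \<Rightarrow> nat \<Rightarrow> real" where
  "quantile_transform n w j = (\<Sum>i = 1..j. increment w (quantile_perm n w i))"

definition nonneg_walk :: "nat \<Rightarrow> (nat \<Rightarrow> real) \<Rightarrow> bool" where
  "nonneg_walk n v \<longleftrightarrow> walk v \<and> (\<forall>j\<in>{0..n}. v j \<ge> 0)"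

definition first_passage_bridge :: "nat \<Rightarrow> (nat \<Rightarrow> real) \<Rightarrow> bool" where
  "first_passage_bridge n v \<longleftrightarrow> walk v \<and> (\<forall>j\<in>{0..<n}. v j \<noteq> v n)"

lemma ex1_quantile_perm: "\<exists>!\<phi>. is_quantile_perm n w \<phi>"
proof -
  define g where "g i = (w (i - 1), i - 1)" for i :: nat
  define xs where "xs = sorted_list_of_set (g ` {1..n})"
  have inj: "inj_on g {1..n}"
    by (auto simp: inj_on_def g_def)
  have len: "length xs = n"
    using card_image[OF inj] by (simp add: xs_def)
  have set: "set xs = g ` {1..n}"
    by (simp add: xs_def)
  have srt: "sorted_wrt (<) xs"
    unfolding xs_def by (rule strict_sorted_list_of_set)
  have iff: "is_quantile_perm n w \<phi> \<longleftrightarrow>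
      \<phi> permutes {1..n} \<and> (\<forall>i\<in>{1..n}. g (\<phi> i) = xs ! (i - 1))" for \<phi>
  proof (intro iffI conjI ballI)
    assume q: "is_quantile_perm n w \<phi>"
    then show p: "\<phi> permutes {1..n}"
      by (simp add: is_quantile_perm_def)
    define ys where "ys = map (g \<circ> \<phi>) [1..<Suc n]"
    have "set ys = g ` \<phi> ` {1..n}"
      unfolding ys_def set_map by (simp only: set_upt image_comp atLeastLessThanSuc_atLeastAtMost)
    then have "set ys = set xs"
      using permutes_image[OF p] set by simp
    moreover have "sorted_wrt (<) ys"
      using q unfolding ys_def sorted_wrt_iff_nth_less
      by (auto simp: is_quantile_perm_def strict_mono_on_def g_def simp del: upt_Suc)
    ultimately have "ys = xs"
      using srt by (intro strict_sorted_equal) auto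
    then show "g (\<phi> i) = xs ! (i - 1)" if "i \<in> {1..n}" for i
      using that by (auto simp: ys_def simp del: upt_Suc)
  next
    assume q: "\<phi> permutes {1..n} \<and> (\<forall>i\<in>{1..n}. g (\<phi> i) = xs ! (i - 1))"
    have "g (\<phi> i) < g (\<phi> j)" if "i \<in> {1..n}" "j \<in> {1..n}" "i < j" for i j
    proof -
      have "xs ! (i - 1) < xs ! (j - 1)"
        using srt that len unfolding sorted_wrt_iff_nth_less by auto
      then show ?thesis
        using q that by simp
    qed
    then show "is_quantile_perm n w \<phi>"
      using q unfolding is_quantile_perm_def strict_mono_on_def g_def by blast
  qed
  define \<psi> where "\<psi> i = (if i \<in> {1..n} then inv_into {1..n} g (xs ! (i - 1)) else i)" for i
  have xs_in: "xs ! (i - 1) \<in> g ` {1..n}" if "i \<in> {1..n}" for i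
    using nth_mem[of "i - 1" xs] that len set by auto
  have g\<psi>: "g (\<psi> i) = xs ! (i - 1)" if "i \<in> {1..n}" for i
    using xs_in[OF that] that unfolding \<psi>_def by (simp add: f_inv_into_f)
  have "\<psi> i \<in> {1..n}" if "i \<in> {1..n}" for i
    using inv_into_into[OF xs_in[OF that]] that by (simp add: \<psi>_def)
  moreover have "inj_on \<psi> {1..n}"
  proof (rule inj_onI)
    fix i j assume ij: "i \<in> {1..n}" "j \<in> {1..n}" "\<psi> i = \<psi> j"
    then have "xs ! (i - 1) = xs ! (j - 1)"
      using g\<psi> by metis
    moreover have "distinct xs"
      by (simp add: xs_def)
    ultimately have "i - 1 = j - 1"
      using ij len by (subst (asm) nth_eq_iff_index_eq) auto
    then show "i = j"
      using ij by auto
  qed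
  ultimately have "bij_betw \<psi> {1..n} {1..n}"
    by (intro bij_betw_imageI endo_inj_surj) auto
  then have "\<psi> permutes {1..n}"
    by (rule bij_imp_permutes) (simp only: \<psi>_def if_False)
  then have "is_quantile_perm n w \<psi>"
    using g\<psi> iff by blast
  moreover have "\<phi> = \<phi>'" if "is_quantile_perm n w \<phi>" "is_quantile_perm n w \<phi>'" for \<phi> \<phi>'
  proof
    fix i
    show "\<phi> i = \<phi>' i"
    proof (cases "i \<in> {1..n}")
      case True
      then have "g (\<phi> i) = g (\<phi>' i)" "\<phi> i \<in> {1..n}" "\<phi>' i \<in> {1..n}"
        using that permutes_in_image[of _ "{1..n}" i] unfolding iff by auto
      then show ?thesis
        using inj by (auto dest: inj_onD)
    next
      case False
      then show ?thesis
        using that permutes_not_in[OF _ False] unfolding iff by metis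
    qed
  qed
  ultimately show ?thesis
    by blast
qed

lemma is_quantile_perm_quantile_perm: "is_quantile_perm n w (quantile_perm n w)"
  unfolding quantile_perm_def by (rule theI'[OF ex1_quantile_perm])

end

theory Submission
  imports Defs
begin

text \<open>
  The first \<open>j\<close> steps of the quantile order start from a set of times that is downward closed for
  the order of the pairs \<open>(w k, k)\<close>. Cut a set of times into maximal intervals \<open>[a, b)\<close>; each
  contributes \<open>w b - w a\<close> to the sum of the increments. If time \<open>n - 1\<close> is not among the first
  \<open>j\<close>, then every right end \<open>b\<close> is a later time outside a downward closed set, so \<open>w b \<ge> w a\<close>.
  Otherwise apply the same to the complementary set, whose increments sum to \<open>w n - Q(w)(j)\<close>: now
  \<open>b\<close> precedes \<open>a\<close> in the quantile order although \<open>a < b\<close>, so \<open>w b < w a\<close>.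
\<close>

text \<open>
  The predicate \<open>P\<close> stands for both \<open>\<ge> 0\<close> and \<open>< 0\<close>. The induction carries the partial sum over
  the current interval, whose left end is \<open>a\<close>.
\<close>

lemma sum_increments_on:
  fixes w :: "nat \<Rightarrow> 'a::ab_group_add"
  assumes add: "\<And>x y. P x \<Longrightarrow> P y \<Longrightarrow> P (x + y)"
    and exit: "\<And>a b. a \<in> C \<Longrightarrow> b \<notin> C \<Longrightarrow> a < b \<Longrightarrow> b \<le> m \<Longrightarrow> P (w b - w a)"
    and "m \<notin> C" and "C \<inter> {..<m} \<noteq> {}"
  shows "P (\<Sum>k\<in>C \<inter> {..<m}. w (Suc k) - w k)"
proof -
  define S where "S l = (\<Sum>k\<in>C \<inter> {..<l}. w (Suc k) - w k)" for l
  have S_Suc: "S (Suc l) = (if l \<in> C then S l + (w (Suc l) - w l) else S l)" for l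
    by (simp add: S_def lessThan_Suc Int_insert_right add.commute)
  have "if l \<in> C then \<exists>a\<in>C. a \<le> l \<and> (S l = w l - w a \<or> P (S l - (w l - w a)))
        else S l = 0 \<and> C \<inter> {..<l} = {} \<or> P (S l)" if "l \<le> m" for l
    using that
  proof (induction l)
    case 0
    then show ?case
      by (auto simp: S_def)
  next
    case (Suc l)
    show ?case
    proof (cases "l \<in> C")
      case True
      then obtain a where a: "a \<in> C" "a \<le> l" "S l = w l - w a \<or> P (S l - (w l - w a))"
        using Suc by auto
      have eq: "S (Suc l) - (w (Suc l) - w a) = S l - (w l - w a)"
        using True by (simp add: S_Suc algebra_simps)
      \<comment> \<open>The interval starting at \<open>a\<close> closes at \<open>Suc l\<close>, so
        \<open>exit\<close> applies to it and \<open>add\<close> joins it to the earlier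
        ones.\<close>
      have "P (S (Suc l))" if "Suc l \<notin> C"
      proof -
        have "P (w (Suc l) - w a)"
          using exit that a Suc.prems by auto
        then show ?thesis
          using a(3) add[of "S l - (w l - w a)" "w (Suc l) - w a"] eq
          by (metis diff_add_cancel eq_iff_diff_eq_0)
      qed
      moreover have "S (Suc l) = w (Suc l) - w a \<or> P (S (Suc l) - (w (Suc l) - w a))"
        using a(3) eq by (metis eq_iff_diff_eq_0)
      ultimately show ?thesis
        using a by (auto intro!: bexI[of _ a])
    next
      case False
      then have "S l = 0 \<and> C \<inter> {..<l} = {} \<or> P (S l)"
        using Suc by auto
      then show ?thesis
        using False by (auto simp: S_Suc lessThan_Suc intro!: bexI[of _ "Suc l"])
    qed
  qed
  from this[of m] show ?thesis
    using assms(3,4) by (simp add: S_def)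
qed

text \<open>Passes from times to ranks: the step of rank \<open>i\<close> starts at time
  \<open>\<phi> i - 1\<close>. Since \<open>inv \<phi> n\<close> is the rank of the last step,
  excluding it makes every interval end at a time that starts a step, and hence has a rank.\<close>

lemma sum_increments_permuted:
  assumes add: "\<And>x y :: real. P x \<Longrightarrow> P y \<Longrightarrow> P (x + y)"
    and \<phi>: "\<phi> permutes {1..n}" and I: "I \<subseteq> {1..n}" "I \<noteq> {}" "inv \<phi> n \<notin> I"
    and exit: "\<And>i i'. i \<in> I \<Longrightarrow> i' \<in> {1..n} - I \<Longrightarrow> \<phi> i < \<phi> i' \<Longrightarrow>
                 P (w (\<phi> i' - 1) - w (\<phi> i - 1))"
  shows "P (\<Sum>i\<in>I. increment w (\<phi> i))"
proof -
  define C where "C = (\<lambda>i. \<phi> i - 1) ` I"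
  have range: "1 \<le> \<phi> i" "\<phi> i \<le> n" if "i \<in> {1..n}" for i
    using permutes_in_image[OF \<phi>, of i] that by auto
  have inj: "inj_on (\<lambda>i. \<phi> i - 1) {1..n}"
  proof (rule inj_onI)
    fix i i' assume i: "i \<in> {1..n}" "i' \<in> {1..n}" "\<phi> i - 1 = \<phi> i' - 1"
    then have "\<phi> i = \<phi> i'"
      using range(1)[of i] range(1)[of i'] by linarith
    then show "i = i'"
      using injD[OF permutes_inj[OF \<phi>]] by metis
  qed
  have C_iff: "\<phi> i - 1 \<in> C \<longleftrightarrow> i \<in> I" if "i \<in> {1..n}" for i
    unfolding C_def by (rule inj_on_image_mem_iff[OF inj that I(1)])
  have onto: "\<exists>i\<in>{1..n}. k = \<phi> i - 1" if "k < n" for k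
  proof -
    have "Suc k \<in> \<phi> ` {1..n}"
      using that unfolding permutes_image[OF \<phi>] by simp
    then obtain i where "i \<in> {1..n}" "Suc k = \<phi> i"
      by auto
    then show ?thesis
      by (metis diff_Suc_1)
  qed
  have n: "n \<ge> 1"
    using I by auto
  have last: "n - 1 \<notin> C"
  proof -
    have "inv \<phi> n \<in> {1..n}"
      using permutes_in_image[OF permutes_inv[OF \<phi>], of n] n by simp
    then show ?thesis
      using C_iff[of "inv \<phi> n"] I(3) by (simp add: permutes_inverses(1)[OF \<phi>])
  qed
  \<comment> \<open>Cutting the sum at \<open>m = n - 1\<close> therefore loses no element of
    \<open>C\<close>.\<close>
  have "k < n - 1" if "k \<in> C" for k
  proof -
    have "k < n"
      using that range I(1) unfolding C_def by fastforce
    then show ?thesis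
      using last that by (cases "k = n - 1") auto
  qed
  then have C: "C \<inter> {..<n - 1} = C"
    by auto
  have "P (\<Sum>k\<in>C \<inter> {..<n - 1}. w (Suc k) - w k)"
  proof (rule sum_increments_on[where P = P, OF add _ last])
    fix a b assume ab: "a \<in> C" "b \<notin> C" "a < b" "b \<le> n - 1"
    obtain i where i: "i \<in> I" "a = \<phi> i - 1"
      using ab by (auto simp: C_def)
    have "b < n"
      using ab n by simp
    then obtain i' where i': "i' \<in> {1..n}" "b = \<phi> i' - 1"
      using onto by blast
    show "P (w b - w a)"
      using exit[of i i'] i i' ab C_iff[of i'] by auto
  qed (use I C in \<open>auto simp: C_def\<close>)
  also have "(\<Sum>k\<in>C \<inter> {..<n - 1}. w (Suc k) - w k) = (\<Sum>i\<in>I. increment w (\<phi> i))"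
    unfolding C
  proof (rule sum.reindex_cong[of "\<lambda>i. \<phi> i - 1" I])
    show "inj_on (\<lambda>i. \<phi> i - 1) I"
      using inj_on_subset[OF inj I(1)] .
    show "w (Suc (\<phi> i - 1)) - w (\<phi> i - 1) = increment w (\<phi> i)" if "i \<in> I" for i
      using range(1)[of i] that I(1) by (simp add: increment_def subset_iff)
  qed (simp add: C_def)
  finally show ?thesis .
qed

lemma quantile_transform_end:
  "quantile_transform n w n = w n - w 0"
proof -
  have "quantile_transform n w n = (\<Sum>i = 1..n. increment w i)"
    unfolding quantile_transform_def
    using is_quantile_perm_quantile_perm[of n w] unfolding is_quantile_perm_def
    by (metis (no_types, lifting) comp_def sum.cong sum.permute)
  also have "\<dots> = w n - w 0"
    by (induction n) (auto simp: increment_def)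
  finally show ?thesis .
qed

lemma quantile_perm_less:
  assumes "i \<in> {1..n}" "j \<in> {1..n}" "i < j"
  shows "(w (quantile_perm n w i - 1), quantile_perm n w i - 1)
       < (w (quantile_perm n w j - 1), quantile_perm n w j - 1)"
  using is_quantile_perm_quantile_perm[of n w] assms
  unfolding is_quantile_perm_def strict_mono_on_def by blast

lemma quantile_transform_nonneg:
  assumes "n \<ge> 1" "j < inv (quantile_perm n w) n"
  shows "quantile_transform n w j \<ge> 0"
\<comment> \<open>The empty sum is split off because the set of ranks must be nonempty.\<close>
proof (cases "j = 0")
  case False
  let ?\<phi> = "quantile_perm n w"
  have \<phi>: "?\<phi> permutes {1..n}"
    using is_quantile_perm_quantile_perm[of n w] by (simp add: is_quantile_perm_def)
  have "inv ?\<phi> n \<le> n"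
    using permutes_in_image[OF permutes_inv[OF \<phi>], of n] assms(1) by simp
  then have j: "j \<le> n"
    using assms(2) by simp
  have "0 \<le> (\<Sum>i\<in>{1..j}. increment w (?\<phi> i))"
  proof (rule sum_increments_permuted[OF _ \<phi>])
    fix i i' assume "i \<in> {1..j}" "i' \<in> {1..n} - {1..j}"
    then show "0 \<le> w (?\<phi> i' - 1) - w (?\<phi> i - 1)"
      using quantile_perm_less[of i n i' w] by (auto simp: less_prod_def)
  qed (use assms(2) j False in auto)
  then show ?thesis
    by (simp add: quantile_transform_def)
qed (simp add: quantile_transform_def)

lemma quantile_transform_greater_end:
  assumes "inv (quantile_perm n w) n \<le> j" "j < n"
  shows "quantile_transform n w j > quantile_transform n w n"
proof -
  let ?\<phi> = "quantile_perm n w"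
  have \<phi>: "?\<phi> permutes {1..n}"
    using is_quantile_perm_quantile_perm[of n w] by (simp add: is_quantile_perm_def)
  have "(\<Sum>i\<in>{j<..n}. increment w (?\<phi> i)) < 0"
  proof (rule sum_increments_permuted[OF _ \<phi>])
    fix i i' assume i: "i \<in> {j<..n}" "i' \<in> {1..n} - {j<..n}" "?\<phi> i < ?\<phi> i'"
    \<comment> \<open>The rank \<open>i'\<close> precedes \<open>i\<close>. Equal values would then
      force the start times into the same order, against \<open>?\<phi> i < ?\<phi> i'\<close>; so
      the inequality is strict.\<close>
    then show "w (?\<phi> i' - 1) - w (?\<phi> i - 1) < 0"
      using quantile_perm_less[of i' n i w] by (auto simp: less_prod_def)
  qed (use assms in auto)
  moreover have "{1..n} = {1..j} \<union> {j<..n}"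
    using assms by auto
  then have "quantile_transform n w n =
      quantile_transform n w j + (\<Sum>i\<in>{j<..n}. increment w (?\<phi> i))"
    unfolding quantile_transform_def by (simp add: sum.union_disjoint ivl_disj_int)
  ultimately show ?thesis
    by simp
qed

theorem theorem2p5:
  fixes n :: nat and w :: "nat \<Rightarrow> real"
  assumes "n \<ge> 1" and "walk w"
  shows "(\<forall>j\<in>{0..<inv (quantile_perm n w) n}. quantile_transform n w j \<ge> 0) \<and>
         (\<forall>j\<in>{inv (quantile_perm n w) n..<n}.
            quantile_transform n w j > quantile_transform n w n) \<and>
         (w n \<ge> 0 \<longrightarrow> nonneg_walk n (quantile_transform n w)) \<and>
         (w n < 0 \<longrightarrow> first_passage_bridge n (quantile_transform n w) \<and>
                      quantile_transform n w n < 0)"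
proof -
  let ?Q = "quantile_transform n w" and ?r = "inv (quantile_perm n w) n"
  have end_eq: "?Q n = w n"
    using assms(2) by (simp add: quantile_transform_end walk_def)
  have start: "walk ?Q"
    by (simp add: walk_def quantile_transform_def)
  have low: "?Q j \<ge> 0" if "j < ?r" for j
    using quantile_transform_nonneg[OF assms(1) that] .
  have high: "?Q j > w n" if "?r \<le> j" "j < n" for j
    using quantile_transform_greater_end[OF that] end_eq by simp
  have "?Q j \<ge> 0" if "w n \<ge> 0" "j \<le> n" for j
    using low[of j] high[of j] that end_eq by (cases "j < ?r"; cases "j = n") auto
  \<comment> \<open>Before \<open>?r\<close> the transform is at least \<open>0 > w n\<close>; from
    \<open>?r\<close> on it exceeds \<open>w n\<close>.\<close>
  moreover have "?Q j \<noteq> w n" if "w n < 0" "j < n" for j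
    using low[of j] high[of j] that by (cases "j < ?r") auto
  ultimately show ?thesis
    using low high end_eq start by (auto simp: nonneg_walk_def first_passage_bridge_def)
qed

end
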